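(* Every $n$-vertex graph $G$ with bandwidth $k$ has $\operatorname{mag}(G)\le 2k(2n-1)$ and $\operatorname{vol}(G)<4k(2n-1)$.
   Context: Graphs are finite, simple and undirected. $P_n^k$ (the $k$-th power of a path) denotes the graph with vertex set $\{v_0,v_1,\dots,v_{n-1}\}$ and edge set $\{v_iv_j:1\le|i-j|\le k\}$. The bandwidth of an $n$-vertex graph $G$ is the minimum $k$ such that $G$ is (isomorphic to) a subgraph of $P_n^k$. An injection $f:V(G)\to\mathbb{Z}^+$ is antimagic if $f(v)+f(w)\neq f(x)+f(y)$ for all distinct edges $vw,xy\in E(G)$. With $[N]=\{1,\dots,N\}$, $\operatorname{mag}(G)$ is the minimum $N$ such that $G$ has an antimagic injection $V(G)\to[N]$. Given an injection $\lambda:V(G)\to\{0,1\}^d$, for each edge $vw$ let $\lambda(vw)$ be the open line segment in $\mathbb{R}^d$ with endpoints $\lambda(v),\lambda(w)$. Two distinct edges cross if their open segments intersect. $\lambda$ is a $d$-dimensional hypercube drawing of $G$ if no two distinct edges cross; its volume is $2^d$. $\operatorname{vol}(G)$ is the minimum volume of a hypercube drawing of $G$.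
   Formalization: The bandwidth k is assumed to be at least 1; an edgeless graph has bandwidth 0, and for it the bounds fail (a single vertex has mag = vol = 1, but both right-hand sides are 0). *)

theory Defs
  imports "HOL-Library.Ramsey" "Jordan_Normal_Form.Matrix"
begin

text \<open>A graph is a pair of a vertex set and a set of two-element sets of vertices.\<close>

definition simple_graph :: "'a set \<Rightarrow> 'a set set \<Rightarrow> bool" where
  "simple_graph V E \<longleftrightarrow> finite V \<and> E \<subseteq> nsets V 2"

definition path_power_edges :: "nat \<Rightarrow> nat \<Rightarrow> nat set set" where
  "path_power_edges n k =
     {{i, j} | i j. i < n \<and> j < n \<and> 1 \<le> \<bar>int i - int j\<bar> \<and> \<bar>int i - int j\<bar> \<le> int k}"

text \<open>The graph \<open>(V, E)\<close> is isomorphic to a (not necessarily induced) subgraph of \<open>(V', E')\<close>.\<close>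

definition subgraph_up_to_iso ::
    "'a set \<Rightarrow> 'a set set \<Rightarrow> 'b set \<Rightarrow> 'b set set \<Rightarrow> bool" where
  "subgraph_up_to_iso V E V' E' \<longleftrightarrow>
     (\<exists>\<phi>. inj_on \<phi> V \<and> \<phi> ` V \<subseteq> V' \<and> (\<forall>e\<in>E. \<phi> ` e \<in> E'))"

text \<open>The minimum ranges over all natural numbers, so an edgeless graph has bandwidth \<open>0\<close>.\<close>

definition bandwidth :: "'a set \<Rightarrow> 'a set set \<Rightarrow> nat" where
  "bandwidth V E =
     (LEAST k. subgraph_up_to_iso V E {..<card V} (path_power_edges (card V) k))"

definition antimagic_injection :: "'a set \<Rightarrow> 'a set set \<Rightarrow> ('a \<Rightarrow> nat) \<Rightarrow> bool" where
  "antimagic_injection V E f \<longleftrightarrow>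
     inj_on f V \<and> (\<forall>v\<in>V. 0 < f v) \<and>
     (\<forall>v w x y. {v, w} \<in> E \<longrightarrow> {x, y} \<in> E \<longrightarrow> {v, w} \<noteq> {x, y} \<longrightarrow> f v + f w \<noteq> f x + f y)"

definition mag :: "'a set \<Rightarrow> 'a set set \<Rightarrow> nat" where
  "mag V E = (LEAST N. \<exists>f. antimagic_injection V E f \<and> f ` V \<subseteq> {1..N})"

text \<open>Points of \<open>d\<close>-dimensional real space are the elements of \<open>carrier_vec d :: real vec set\<close>, since
  \<open>d\<close> has to vary inside the definition of the minimum volume.\<close>

definition hypercube_vertices :: "nat \<Rightarrow> real vec set" where
  "hypercube_vertices d = {p \<in> carrier_vec d. \<forall>i<d. p $ i \<in> {0, 1}}"

definition open_segment_vec :: "real vec \<Rightarrow> real vec \<Rightarrow> real vec set" where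
  "open_segment_vec p q = {(1 - t) \<cdot>\<^sub>v p + t \<cdot>\<^sub>v q | t. 0 < t \<and> t < 1}"

definition hypercube_drawing :: "'a set \<Rightarrow> 'a set set \<Rightarrow> nat \<Rightarrow> ('a \<Rightarrow> real vec) \<Rightarrow> bool" where
  "hypercube_drawing V E d l \<longleftrightarrow>
     inj_on l V \<and> l ` V \<subseteq> hypercube_vertices d \<and>
     (\<forall>v w x y. {v, w} \<in> E \<longrightarrow> {x, y} \<in> E \<longrightarrow> {v, w} \<noteq> {x, y} \<longrightarrow>
        open_segment_vec (l v) (l w) \<inter> open_segment_vec (l x) (l y) = {})"

definition vol :: "'a set \<Rightarrow> 'a set set \<Rightarrow> nat" where
  "vol V E = (LEAST N. \<exists>d l. hypercube_drawing V E d l \<and> N = 2 ^ d)"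

end

theory Submission
  imports Defs "HOL.Binomial_Plus" "HOL-Library.Discrete_Functions" "HOL-Computational_Algebra.Primes"
begin

text \<open>
  Embed the graph into \<open>P\<^sub>n\<^sup>k\<close>, let \<open>i\<close> be the position of a vertex there, and take a prime \<open>p\<close> with
  \<open>k < p \<le> 2k\<close>, which exists by Bertrand's postulate (here by Erdos's argument). The label
  \<open>2pi + (i\<^sup>2 mod p) + 1\<close> is at most \<open>p(2n - 1)\<close>, and the sum of the labels of an edge \<open>ij\<close> determines
  \<open>i + j\<close> and \<open>i\<^sup>2 + j\<^sup>2\<close> modulo \<open>p\<close>. Hence it determines \<open>(i - j)\<^sup>2\<close> modulo \<open>p\<close> and the parity of \<open>i - j\<close>,
  and so \<open>\<bar>i - j\<bar> \<le> k < p\<close> itself. For the volume, read the labels in binary: two crossing edges have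
  the same midpoint, hence the same sum of labels.
\<close>

section \<open>Bertrand's postulate\<close>

text \<open>The sum counts the exponents from 1 up to the multiplicity; the bound on
  \<open>m\<close> ensures that none lies beyond \<open>L\<close>. So \<open>L\<close> truncates the
  infinite sum of Legendre's formula without loss.\<close>

lemma multiplicity_eq_sum_dvd:
  fixes m p L :: nat
  assumes "prime p" "0 < m" "m < p ^ Suc L"
  shows "multiplicity p m = (\<Sum>i = 1..L. if p ^ i dvd m then 1 else 0)"
proof -
  have "\<not> p ^ Suc L dvd m"
    using assms by (auto dest: dvd_imp_le)
  then have le: "multiplicity p m \<le> L"
    by (meson multiplicity_dvd' not_less_eq_eq)
  have "p ^ i dvd m \<longleftrightarrow> i \<le> multiplicity p m" for i
    using assms by (intro power_dvd_iff_le_multiplicity) (auto simp: prime_nat_iff)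
  then have "(\<Sum>i = 1..L. if p ^ i dvd m then 1 else 0) = card {i \<in> {1..L}. i \<le> multiplicity p m}"
    by (simp add: sum.If_cases Int_def)
  also have "{i \<in> {1..L}. i \<le> multiplicity p m} = {1..multiplicity p m}"
    using le by auto
  finally show ?thesis by simp
qed

text \<open>Legendre's formula: going from \<open>n\<close> to \<open>Suc n\<close> raises
  \<open>n div p ^ i\<close> by one exactly when \<open>p ^ i\<close> divides
  \<open>Suc n\<close>.\<close>

lemma multiplicity_fact:
  fixes p L n :: nat
  assumes "prime p" "n < p ^ Suc L"
  shows "multiplicity p (fact n) = (\<Sum>i = 1..L. n div p ^ i)"
  using assms(2)
proof (induction n)
  case 0
  then show ?case by simp
next
  case (Suc n)
  have "multiplicity p (fact (Suc n) :: nat) = multiplicity p (Suc n) + multiplicity p (fact n :: nat)"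
    using assms(1) by (simp only: fact_Suc of_nat_id)
      (subst prime_elem_multiplicity_mult_distrib, auto)
  also have "\<dots> = (\<Sum>i = 1..L. (if p ^ i dvd Suc n then 1 else 0) + n div p ^ i)"
    using Suc assms(1) by (simp add: multiplicity_eq_sum_dvd[where L = L] sum.distrib)
  also have "\<dots> = (\<Sum>i = 1..L. Suc n div p ^ i)"
    by (intro sum.cong) (auto simp: div_Suc dvd_eq_mod_eq_0)
  finally show ?case .
qed

lemma multiplicity_central_binomial:
  fixes p L n :: nat
  assumes "prime p" "2 * n < p ^ Suc L"
  shows "multiplicity p (2 * n choose n) = (\<Sum>i = 1..L. (2 * n) div p ^ i - 2 * (n div p ^ i))"
proof -
  have "fact n * fact n * (2 * n choose n) = (fact (2 * n) :: nat)"
    using binomial_fact_lemma[of n "2 * n"] by (simp add: mult_2)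
  then have "multiplicity p (fact (2 * n) :: nat) = multiplicity p (fact n * fact n * (2 * n choose n))"
    by simp
  also have "\<dots> = 2 * multiplicity p (fact n :: nat) + multiplicity p (2 * n choose n)"
    using assms(1) by (simp add: prime_elem_multiplicity_mult_distrib)
  finally have "multiplicity p (2 * n choose n) =
      (\<Sum>i = 1..L. (2 * n) div p ^ i) - (\<Sum>i = 1..L. 2 * (n div p ^ i))"
    using assms by (simp add: multiplicity_fact[where L = L] sum_distrib_left)
  \<comment> \<open>Subtraction on \<open>nat\<close> is exact in each term, since doubling a
    quotient never exceeds the quotient of the double.\<close>
  also have "\<dots> = (\<Sum>i = 1..L. (2 * n) div p ^ i - 2 * (n div p ^ i))"
    by (intro sum_subtractf_nat[symmetric]) (metis mult_2 div_add1_eq le_add1)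
  finally show ?thesis .
qed

text \<open>Each of the \<open>L\<close> terms of the formula above is 0 or 1, as doubling a number
  raises its doubled floor by at most one.\<close>

lemma multiplicity_central_binomial_le:
  fixes p L n :: nat
  assumes "prime p" "2 * n < p ^ Suc L"
  shows "multiplicity p (2 * n choose n) \<le> L"
proof -
  have "(2 * n) div q - 2 * (n div q) \<le> 1" for q
  proof (cases "q = 0")
    case False
    then have "n < (n div q + 1) * q"
      using dividend_less_div_times[of q n] by simp
    then have "2 * n < (2 * (n div q) + 2) * q"
      by (simp add: algebra_simps)
    then have "(2 * n) div q < 2 * (n div q) + 2"
      using False by (simp add: div_less_iff_less_mult)
    then show ?thesis by linarith
  qed simp
  then have "(\<Sum>i = 1..L. (2 * n) div p ^ i - 2 * (n div p ^ i)) \<le> (\<Sum>i = 1..L. 1)"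
    by (intro sum_mono)
  then show ?thesis
    using multiplicity_central_binomial[OF assms] by simp
qed

lemma prime_power_central_binomial_le:
  fixes p n :: nat
  assumes "prime p" "0 < n"
  shows "p ^ multiplicity p (2 * n choose n) \<le> 2 * n"
proof -
  \<comment> \<open>\<open>L\<close> is the integer part of the logarithm of \<open>2 * n\<close> to
    base \<open>p\<close>.\<close>
  obtain L where L: "p ^ L \<le> 2 * n" "2 * n < p ^ Suc L"
    using ex_power_ivl1[of p "2 * n"] assms prime_ge_2_nat by auto
  then have "p ^ multiplicity p (2 * n choose n) \<le> p ^ L"
    using assms by (intro power_increasing multiplicity_central_binomial_le) (auto simp: prime_gt_0_nat Suc_leI)
  with L show ?thesis by linarith
qed

text \<open>The factors \<open>p\<close> and \<open>2 * p\<close> of \<open>fact (2 * n)\<close>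
  cancel against the two copies of \<open>p\<close> in \<open>fact n * fact n\<close>. From
  \<open>3 \<le> p\<close> follows \<open>2 * n < p * p\<close>, so higher powers do not
  occur.\<close>

lemma multiplicity_central_binomial_eq_0:
  fixes p n :: nat
  assumes "prime p" "3 \<le> p" "p \<le> n" "2 * n < 3 * p"
  shows "multiplicity p (2 * n choose n) = 0"
proof -
  have "3 * p \<le> p * p"
    using assms(2) by (intro mult_right_mono) auto
  then have "2 * n < p * p"
    using assms(4) by linarith
  then have "2 * n < p ^ Suc 1"
    by simp
  moreover have "(2 * n) div p = 2" "n div p = 1"
    using assms by (auto intro!: div_nat_eqI)
  ultimately show ?thesis
    using multiplicity_central_binomial[OF assms(1), of n 1] by simp
qed

section \<open>The bound on the product of the primes up to \<open>n\<close>\<close>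

text \<open>The two middle entries of this row are equal, and the whole row sums to
  \<open>2 * 4 ^ k\<close>.\<close>

lemma odd_central_binomial_le: "(2 * k + 1) choose k \<le> 4 ^ k"
proof -
  have eq: "(2 * k + 1) choose (k + 1) = (2 * k + 1) choose k"
    using binomial_symmetric[of k "2 * k + 1"] by simp
  have "2 * ((2 * k + 1) choose k) = (\<Sum>i\<in>{k, k + 1}. (2 * k + 1) choose i)"
    using eq by simp
  also have "\<dots> \<le> (\<Sum>i\<le>2 * k + 1. (2 * k + 1) choose i)"
    by (intro sum_mono2) auto
  also have "\<dots> = 2 * 4 ^ k"
    by (simp add: choose_row_sum power_mult del: sum.atMost_Suc)
  finally show ?thesis by simp
qed

lemma prod_primes_dvd:
  fixes m :: nat
  assumes "finite A" "\<And>p. p \<in> A \<Longrightarrow> prime p \<and> p dvd m"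
  shows "\<Prod>A dvd m"
  using assms
proof (induction A)
  case (insert p A)
  have "coprime p (\<Prod>A)"
    using insert by (intro prod_coprime_right primes_coprime) auto
  then show ?case
    using insert by (auto intro!: divides_mult)
qed simp

text \<open>An even \<open>n > 2\<close> is not prime and adds nothing to \<open>n - 1\<close>. For
  \<open>n = 2 * k + 1\<close> the primes up to \<open>k + 1\<close> fall under the induction
  hypothesis, and the others divide \<open>n choose k\<close>.\<close>

lemma primorial_le: "\<Prod>{p::nat. prime p \<and> p \<le> n} \<le> 4 ^ n"
proof (induction n rule: less_induct)
  case (less n)
  consider "n \<le> 1" | "n = 2" | k where "n = 2 * k + 1" "1 \<le> k" | "even n" "2 < n"
  proof (cases "even n")
    case True
    then show ?thesis using that(1,2,4) by linarith
  next
    case False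
    then obtain k where "n = 2 * k + 1" by (rule oddE)
    then show ?thesis using that(1,3) by (cases "k = 0") auto
  qed
  then show ?case
  proof cases
    case 1
    then have "{p::nat. prime p \<and> p \<le> n} = {}"
      by (auto dest!: prime_gt_1_nat)
    then show ?thesis by (metis one_le_power one_le_numeral prod.empty)
  next
    case 2
    then have "{p::nat. prime p \<and> p \<le> n} = {2}"
      by (auto dest: prime_ge_2_nat)
    then show ?thesis using 2 by simp
  next
    case (3 k)
    let ?A = "{p. prime p \<and> p \<le> k + 1}" and ?B = "{p. prime p \<and> k + 1 < p \<and> p \<le> n}"
    \<comment> \<open>Such a \<open>p\<close> divides \<open>fact n\<close>, but neither
      \<open>fact k\<close> nor \<open>fact (n - k)\<close>, because
      \<open>n - k = k + 1 < p\<close>.\<close>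
    have "p dvd n choose k" if "p \<in> ?B" for p
    proof -
      have "fact k * fact (n - k) * (n choose k) = (fact n :: nat)"
        using 3 by (intro binomial_fact_lemma) auto
      then have "p dvd fact k * fact (n - k) * (n choose k)"
        using that by (simp add: prime_dvd_fact_iff)
      moreover have "k < p" "n - k < p" "prime p"
        using that 3 by auto
      ultimately show ?thesis
        by (metis not_less prime_dvd_fact_iff prime_dvd_mult_iff)
    qed
    then have "\<Prod>?B dvd n choose k"
      by (intro prod_primes_dvd) auto
    then have "\<Prod>?B \<le> n choose k"
      using 3 by (intro dvd_imp_le) auto
    also have "\<dots> \<le> 4 ^ k"
      using odd_central_binomial_le[of k] 3 by simp
    finally have B: "\<Prod>?B \<le> 4 ^ k" .
    have "{p::nat. prime p \<and> p \<le> n} = ?A \<union> ?B"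
      using 3 by auto
    then have "\<Prod>{p::nat. prime p \<and> p \<le> n} = \<Prod>?A * \<Prod>?B"
      by (simp only:) (rule prod.union_disjoint, auto)
    also have "\<dots> \<le> 4 ^ (k + 1) * 4 ^ k"
      using less.IH[of "k + 1"] B 3 by (intro mult_mono) auto
    also have "\<dots> = 4 ^ n"
      using 3 by (simp add: power_add[symmetric] mult_2)
    finally show ?thesis .
  next
    case 4
    then have "\<not> prime n"
      using prime_odd_nat by blast
    then have "prime p \<and> p \<le> n \<longleftrightarrow> prime p \<and> p \<le> n - 1" for p
      using 4 by (cases "p = n") auto
    then have "\<Prod>{p::nat. prime p \<and> p \<le> n} \<le> 4 ^ (n - 1)"
      using less.IH[of "n - 1"] 4 by simp
    also have "\<dots> \<le> (4::nat) ^ n"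
      by (intro power_increasing) auto
    finally show ?thesis .
  qed
qed

section \<open>Erdos's estimate for large \<open>n\<close> and a chain of primes for small
  \<open>n\<close>\<close>

text \<open>Equality holds at 32, both sides being \<open>2 ^ 30\<close>. Each step multiplies the
  left side by at most \<open>(33 / 32) ^ 6 < 2\<close>; the factor \<open>32 ^ 6\<close> keeps this
  in the natural numbers.\<close>

lemma pow6_le_pow2: "32 \<le> t \<Longrightarrow> t ^ 6 \<le> (2::nat) ^ (t - 2)"
proof (induction t rule: dec_induct)
  case base
  then show ?case by simp
next
  case (step t)
  have "32 ^ 6 * Suc t ^ 6 = (32 * Suc t) ^ 6"
    by (simp only: power_mult_distrib)
  also have "\<dots> \<le> (33 * t) ^ 6"
    using step by (intro power_mono) auto
  also have "\<dots> = 33 ^ 6 * t ^ 6"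
    by (simp only: power_mult_distrib)
  also have "\<dots> \<le> (32 ^ 6 * 2) * t ^ 6"
    by (intro mult_right_mono) auto
  finally have "Suc t ^ 6 \<le> 2 * t ^ 6" by simp
  also have "\<dots> \<le> 2 * 2 ^ (t - 2)"
    using step by simp
  also have "\<dots> = 2 ^ (Suc t - 2)"
    using step by (simp add: Suc_diff_le flip: power_Suc)
  finally show ?case .
qed

text \<open>Without primes in \<open>(n, 2n]\<close>, the primes up to \<open>\<surd>(2n)\<close> contribute at most \<open>2n\<close> each to the
  central binomial coefficient, and the larger ones occur once and are at most \<open>2n/3\<close>.\<close>

lemma central_binomial_le_if_no_prime:
  fixes n :: nat
  assumes "3 \<le> n" "\<And>p. prime p \<Longrightarrow> n < p \<Longrightarrow> p \<le> 2 * n \<Longrightarrow> False"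
  shows "2 * n choose n \<le> (2 * n) ^ floor_sqrt (2 * n) * 4 ^ (2 * n div 3)"
proof -
  let ?C = "2 * n choose n" and ?s = "floor_sqrt (2 * n)"
  let ?A = "{p \<in> prime_factors ?C. p \<le> ?s}" and ?B = "{p \<in> prime_factors ?C. ?s < p}"
  have split: "prime_factors ?C = ?A \<union> ?B" by auto
  have "?C = (\<Prod>p\<in>prime_factors ?C. p ^ multiplicity p ?C)"
    by (intro prime_factorization_nat) auto
  also have "\<dots> = (\<Prod>p\<in>?A \<union> ?B. p ^ multiplicity p ?C)"
    by (subst split) simp
  also have "\<dots> = (\<Prod>p\<in>?A. p ^ multiplicity p ?C) * (\<Prod>p\<in>?B. p ^ multiplicity p ?C)"
    by (intro prod.union_disjoint) auto
  also have "\<dots> \<le> (2 * n) ^ ?s * 4 ^ (2 * n div 3)"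
  proof (intro mult_mono)
    have "(\<Prod>p\<in>?A. p ^ multiplicity p ?C) \<le> (\<Prod>p\<in>?A. 2 * n)"
      using assms(1) by (intro prod_mono) (auto intro!: prime_power_central_binomial_le)
    also have "\<dots> = (2 * n) ^ card ?A" by simp
    also have "\<dots> \<le> (2 * n) ^ ?s"
    proof (rule power_increasing)
      have "card ?A \<le> card {1..?s}"
        by (intro card_mono) (auto simp: in_prime_factors_iff prime_gt_0_nat Suc_leI)
      then show "card ?A \<le> ?s" by simp
    qed (use assms(1) in simp)
    finally show "(\<Prod>p\<in>?A. p ^ multiplicity p ?C) \<le> (2 * n) ^ ?s" .
    have B: "prime p \<and> p \<le> 2 * n div 3 \<and> multiplicity p ?C \<le> 1" if "p \<in> ?B" for p
    proof -
      have p: "prime p" "p dvd ?C" "?s < p"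
        using that by (auto simp: in_prime_factors_iff)
      \<comment> \<open>Beyond the square root only the first power of \<open>p\<close> can count,
        so \<open>L = 1\<close>.\<close>
      have "2 * n < p ^ Suc 1"
        using p(3) by (metis Suc_1 not_le le_floor_sqrtI)
      then have mult: "multiplicity p ?C \<le> 1"
        using p by (intro multiplicity_central_binomial_le)
      have "?C dvd fact (2 * n)"
        using binomial_fact_lemma[of n "2 * n"] by (metis dvd_triv_right le_add1 mult_2)
      then have "p \<le> 2 * n"
        using p dvd_trans prime_dvd_fact_iff by blast
      then have "p \<le> n"
        using assms(2)[OF p(1)] not_le by blast
      moreover have "multiplicity p ?C \<noteq> 0"
        using p by (auto simp: multiplicity_eq_zero_iff prime_nat_iff)
      \<comment> \<open>This gives \<open>3 \<le> p\<close>, so that no prime with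
        \<open>2 * n < 3 * p\<close> and \<open>p \<le> n\<close> can divide the
        coefficient.\<close>
      moreover have "2 \<le> ?s"
        using assms(1) by (intro le_floor_sqrtI) auto
      ultimately have "3 * p \<le> 2 * n"
        using multiplicity_central_binomial_eq_0[OF p(1), of n] p(3) by linarith
      with mult p show ?thesis by simp
    qed
    have "(\<Prod>p\<in>?B. p ^ multiplicity p ?C) \<le> \<Prod>?B"
    proof (intro prod_mono conjI)
      fix p assume "p \<in> ?B"
      then have "p ^ multiplicity p ?C \<le> p ^ 1"
        using B[of p] by (intro power_increasing) (auto simp: prime_gt_0_nat Suc_leI)
      then show "p ^ multiplicity p ?C \<le> p" by simp
    qed simp
    also have "\<dots> \<le> \<Prod>{p. prime p \<and> p \<le> 2 * n div 3}"
      using B by (intro dvd_imp_le prod_dvd_prod_subset prod_pos) (auto simp: prime_gt_0_nat)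
    also have "\<dots> \<le> 4 ^ (2 * n div 3)"
      by (rule primorial_le)
    finally show "(\<Prod>p\<in>?B. p ^ multiplicity p ?C) \<le> 4 ^ (2 * n div 3)" .
  qed auto
  finally show ?thesis .
qed

lemma exists_prime_between_large:
  fixes n :: nat
  assumes "481 \<le> n"
  obtains p where "prime p" "n < p" "p \<le> 2 * n"
proof (rule ccontr)
  assume "\<not> thesis"
  then have no: "\<And>p. prime p \<Longrightarrow> n < p \<Longrightarrow> p \<le> 2 * n \<Longrightarrow> False"
    using that by blast
  \<comment> \<open>The successor serves twice: it absorbs the extra factor \<open>2 * n\<close>
    into the power below, and it makes \<open>2 * n < t ^ 2\<close>.\<close>
  define t where "t = Suc (floor_sqrt (2 * n))"
  \<comment> \<open>481 is the least \<open>n\<close> with \<open>31 ^ 2 \<le> 2 * n\<close>; it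
    puts \<open>t\<close> in the range of \<open>pow6_le_pow2\<close>.\<close>
  have "31 \<le> floor_sqrt (2 * n)"
    using assms by (intro le_floor_sqrtI) auto
  then have t: "32 \<le> t" by (simp add: t_def)
  have t_gt: "2 * n < t ^ 2" unfolding t_def by (rule Suc_floor_sqrt_power2_gt)
  have t_le: "(t - 1) ^ 2 \<le> 2 * n" unfolding t_def by simp
  have "real (4 ^ n) \<le> real (2 * n * (2 * n choose n))"
    using central_binomial_lower_bound[of n] assms by (simp add: field_simps)
  then have "4 ^ n \<le> 2 * n * (2 * n choose n)"
    by (simp only: of_nat_le_iff)
  also have "\<dots> \<le> 2 * n * ((2 * n) ^ (t - 1) * 4 ^ (2 * n div 3))"
    using central_binomial_le_if_no_prime[of n] no assms by (intro mult_left_mono) (auto simp: t_def)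
  also have "\<dots> = (2 * n) ^ t * 4 ^ (2 * n div 3)"
    using t by (simp add: power_eq_if)
  finally have "4 ^ (n - 2 * n div 3) * 4 ^ (2 * n div 3) \<le> (2 * n) ^ t * 4 ^ (2 * n div 3)"
    by (simp flip: power_add)
  then have *: "4 ^ (n - 2 * n div 3) \<le> (2 * n) ^ t"
    by simp
  \<comment> \<open>Cubing \<open>*\<close> removes the division by 3 and bounds everything by
    powers of 2 in \<open>t\<close> alone. The exponents then clash, as
    \<open>(t - 1) ^ 2 = (t - 2) * t + 1\<close>.\<close>
  have "(2::nat) ^ ((t - 1) ^ 2) \<le> 2 ^ (2 * n)"
    using t_le by (intro power_increasing) auto
  also have "\<dots> = 4 ^ n" by (simp add: power_mult)
  also have "\<dots> \<le> 4 ^ ((n - 2 * n div 3) * 3)"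
    by (intro power_increasing) auto
  also have "\<dots> = (4 ^ (n - 2 * n div 3)) ^ 3" by (simp only: power_mult)
  also have "\<dots> \<le> ((2 * n) ^ t) ^ 3"
    using * by (intro power_mono) auto
  also have "\<dots> \<le> ((t ^ 2) ^ t) ^ 3"
    using t_gt by (intro power_mono) auto
  also have "\<dots> = (t ^ 6) ^ t"
    by (simp flip: power_mult add: mult_ac)
  also have "\<dots> \<le> (2 ^ (t - 2)) ^ t"
    using pow6_le_pow2[OF t] by (intro power_mono) auto
  also have "\<dots> = 2 ^ ((t - 2) * t)"
    by (simp add: power_mult)
  finally have "(t - 1) ^ 2 \<le> (t - 2) * t"
    by simp
  moreover obtain u where "t = 2 + u"
    using t le_Suc_ex[of 2 t] by auto
  ultimately show False
    by (simp add: power2_eq_square algebra_simps)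
qed

lemma exists_prime_between:
  fixes n :: nat
  assumes "1 \<le> n"
  obtains p where "prime p" "n < p" "p \<le> 2 * n"
proof (cases "481 \<le> n")
  case True
  then show ?thesis using exists_prime_between_large that by blast
next
  case False
  have primes: "prime (2::nat)" "prime (3::nat)" "prime (5::nat)" "prime (7::nat)" "prime (13::nat)"
    "prime (23::nat)" "prime (43::nat)" "prime (83::nat)" "prime (163::nat)" "prime (317::nat)"
    "prime (631::nat)"
    by simp_all
  \<comment> \<open>Each prime in the list is less than twice its predecessor, so the first one
    above \<open>n\<close> is at most \<open>2 * n\<close>.\<close>
  define p :: nat where "p = (if n < 2 then 2 else if n < 3 then 3 else if n < 5 then 5
    else if n < 7 then 7 else if n < 13 then 13 else if n < 23 then 23 else if n < 43 then 43
    else if n < 83 then 83 else if n < 163 then 163 else if n < 317 then 317 else 631)"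
  have prime_if: "prime (if b then x else y)" if "prime x" "prime y" for b and x y :: nat
    using that by simp
  have "prime p"
    unfolding p_def by (intro prime_if primes)
  moreover have "n < p" "p \<le> 2 * n"
    using assms False unfolding p_def by (simp_all split: if_split)
  ultimately show ?thesis by (rule that)
qed

section \<open>Antimagic injections of powers of paths\<close>

text \<open>With equal sums the two pairs differ by a shift \<open>a\<close> inwards, and the sums
  of squares differ by \<open>- 2 * a * b\<close>, where \<open>b\<close> is the mean of the two
  gaps. Both \<open>\<bar>a\<bar>\<close> and \<open>b\<close> are below \<open>p\<close>, and
  \<open>b\<close> is positive, so divisibility by \<open>p\<close> leaves
  \<open>a = 0\<close>.\<close>

lemma edge_sum_squares_inj:
  fixes i j i' j' p k :: int
  assumes p: "prime p" "k < p"
    and ij: "i < j" "j - i \<le> k" and ij': "i' < j'" "j' - i' \<le> k"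
    and sum: "i + j = i' + j'"
    and sq: "(i\<^sup>2 + j\<^sup>2) mod p = (i'\<^sup>2 + j'\<^sup>2) mod p"
  shows "i = i' \<and> j = j'"
proof -
  define a where "a = i - i'"
  define b where "b = j' - i' - a"
  have j: "j = j' - a" and i: "i = i' + a"
    using sum by (auto simp: a_def)
  have "i\<^sup>2 + j\<^sup>2 - (i'\<^sup>2 + j'\<^sup>2) = - (2 * a * b)"
    unfolding i j b_def by (simp add: power2_eq_square algebra_simps)
  then have "p dvd 2 * a * b"
    using sq by (metis mod_eq_dvd_iff dvd_minus_iff)
  then consider "p dvd 2" | "p dvd a" | "p dvd b"
    using p by (auto simp: prime_dvd_mult_iff)
  then have "a = 0"
  proof cases
    \<comment> \<open>Here \<open>k < p \<le> 2\<close>, so both gaps are 1.\<close>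
    case 1
    then have "p \<le> 2" by (rule zdvd_imp_le) simp
    then show ?thesis using p ij ij' sum by (auto simp: a_def)
  next
    case 2
    then show ?thesis
      using p ij ij' sum zdvd_imp_le[of p "\<bar>a\<bar>"] by (cases "a = 0") (auto simp: a_def)
  next
    case 3
    have "b > 0" "b \<le> k"
      using ij ij' sum by (auto simp: a_def b_def)
    with 3 p show ?thesis using zdvd_imp_le[of p b] by simp
  qed
  then show ?thesis using i j by simp
qed

lemma simple_graph_edgeD:
  assumes "simple_graph V E" "{v, w} \<in> E"
  shows "v \<in> V" "w \<in> V" "v \<noteq> w"
  using assms by (auto simp: simple_graph_def nsets_def card_insert_if split: if_splits)

lemma antimagic_injection_quadratic:
  fixes \<phi> :: "'a \<Rightarrow> nat"
  assumes graph: "simple_graph V E"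
    and \<phi>: "inj_on \<phi> V" "\<forall>e\<in>E. \<phi> ` e \<in> path_power_edges n k"
    and p: "prime p" "k < p"
  shows "antimagic_injection V E (\<lambda>v. 2 * p * \<phi> v + (\<phi> v)\<^sup>2 mod p + 1)"
proof -
  define r where "r v = (\<phi> v)\<^sup>2 mod p" for v
  \<comment> \<open>Base \<open>2 * p\<close> instead of \<open>p\<close> leaves room to add the
    residues of two endpoints without a carry. The final 1 makes labels positive.\<close>
  define f where "f v = 2 * p * \<phi> v + r v + 1" for v
  have p_pos: "0 < p" using p by simp
  have r: "r v < p" for v using p_pos by (simp add: r_def)
  have digits: "s = s' \<and> q = q'"
    if "m * s + q = m * s' + q'" "q < m" "q' < m" for m s q s' q' :: nat
  proof -
    have "m \<noteq> 0" using that(2) by simp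
    then have "s = s'"
      using arg_cong[OF that(1), of "\<lambda>x. x div m"] that(2,3) by simp
    then show ?thesis using that(1) by simp
  qed
  have "inj_on f V"
  proof (rule inj_onI)
    fix v w assume vw: "v \<in> V" "w \<in> V" "f v = f w"
    have "\<phi> v = \<phi> w"
      using digits[of "2 * p" "\<phi> v" "r v" "\<phi> w" "r w"] vw(3) r[of v] r[of w] by (simp add: f_def)
    then show "v = w" using \<phi>(1) vw by (simp add: inj_on_eq_iff)
  qed
  moreover have "{v, w} = {x, y}"
    if E: "{v, w} \<in> E" "{x, y} \<in> E" and sum: "f v + f w = f x + f y" for v w x y
  proof -
    have edge: "\<bar>int (\<phi> a) - int (\<phi> b)\<bar> \<le> int k" if "{a, b} \<in> E" for a b
    proof -
      have "{\<phi> a, \<phi> b} \<in> path_power_edges n k"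
        using \<phi>(2) that by fastforce
      then show ?thesis
        by (auto simp: path_power_edges_def doubleton_eq_iff)
    qed
    \<comment> \<open>\<open>edge_sum_squares_inj\<close> compares pairs in increasing order; the
      four orientations of two edges are reduced to this one at the end.\<close>
    have ordered: "v = x \<and> w = y"
      if E: "{v, w} \<in> E" "{x, y} \<in> E" and sum: "f v + f w = f x + f y"
        and less: "\<phi> v < \<phi> w" "\<phi> x < \<phi> y" for v w x y
    proof -
      have s: "\<phi> v + \<phi> w = \<phi> x + \<phi> y" and q: "r v + r w = r x + r y"
        using digits[of "2 * p" "\<phi> v + \<phi> w" "r v + r w" "\<phi> x + \<phi> y" "r x + r y"]
          sum r[of v] r[of w] r[of x] r[of y] by (auto simp: f_def algebra_simps)
      from q have "((\<phi> v)\<^sup>2 + (\<phi> w)\<^sup>2) mod p = ((\<phi> x)\<^sup>2 + (\<phi> y)\<^sup>2) mod p"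
        unfolding r_def by (metis mod_add_eq)
      then have "int (((\<phi> v)\<^sup>2 + (\<phi> w)\<^sup>2) mod p) = int (((\<phi> x)\<^sup>2 + (\<phi> y)\<^sup>2) mod p)"
        by simp
      then have sq: "((int (\<phi> v))\<^sup>2 + (int (\<phi> w))\<^sup>2) mod int p =
          ((int (\<phi> x))\<^sup>2 + (int (\<phi> y))\<^sup>2) mod int p"
        by (simp add: zmod_int)
      have "int (\<phi> v) = int (\<phi> x) \<and> int (\<phi> w) = int (\<phi> y)"
        using edge[OF E(1)] edge[OF E(2)] s less p
        by (intro edge_sum_squares_inj[OF _ _ _ _ _ _ _ sq, of "int k"]) auto
      then show ?thesis
        using simple_graph_edgeD[OF graph E(1)] simple_graph_edgeD[OF graph E(2)] \<phi>(1)
        by (simp add: inj_on_eq_iff)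
    qed
    have ne: "\<phi> a \<noteq> \<phi> b" if "{a, b} \<in> E" for a b
      using simple_graph_edgeD[OF graph that] \<phi>(1) by (simp add: inj_on_eq_iff)
    have comm: "{w, v} \<in> E" "{y, x} \<in> E" "f w + f v = f x + f y" "f v + f w = f y + f x"
        "f w + f v = f y + f x"
      using E sum by (simp_all add: insert_commute add.commute)
    consider "\<phi> v < \<phi> w" "\<phi> x < \<phi> y" | "\<phi> v < \<phi> w" "\<phi> y < \<phi> x"
      | "\<phi> w < \<phi> v" "\<phi> x < \<phi> y" | "\<phi> w < \<phi> v" "\<phi> y < \<phi> x"
      using ne[OF E(1)] ne[OF E(2)] by linarith
    then show ?thesis
    proof cases
      case 1
      then show ?thesis using ordered[of v w x y] E sum by simp
    next
      case 2
      then show ?thesis using ordered[of v w y x] E comm by auto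
    next
      case 3
      then show ?thesis using ordered[of w v x y] E comm by auto
    next
      case 4
      then show ?thesis using ordered[of w v y x] E comm by auto
    qed
  qed
  moreover have "0 < f v" for v by (simp add: f_def)
  ultimately have "antimagic_injection V E f"
    unfolding antimagic_injection_def by blast
  then show ?thesis
    by (simp add: f_def[abs_def] r_def)
qed

section \<open>Hypercube drawings from antimagic injections\<close>

text \<open>A coordinate of an interior point of a segment is \<open>0\<close> or \<open>1\<close> if the endpoints agree in it, and strictly
  between otherwise; so crossing segments have the same midpoint.\<close>

lemma crossing_coordinate_sums:
  fixes a b c e :: real
  assumes "a \<in> {0, 1}" "b \<in> {0, 1}" "c \<in> {0, 1}" "e \<in> {0, 1}"
    and "0 < t" "t < 1" "0 < u" "u < 1"
    and "(1 - t) * a + t * b = (1 - u) * c + u * e"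
  shows "a + b = c + e"
  using assms by auto

lemma open_segments_disjoint:
  assumes vs: "p \<in> hypercube_vertices d" "q \<in> hypercube_vertices d"
      "r \<in> hypercube_vertices d" "s \<in> hypercube_vertices d"
    and ne: "\<exists>i<d. p $ i + q $ i \<noteq> r $ i + s $ i"
  shows "open_segment_vec p q \<inter> open_segment_vec r s = {}"
proof (rule ccontr)
  assume "open_segment_vec p q \<inter> open_segment_vec r s \<noteq> {}"
  then obtain t u where t: "0 < t" "t < 1" "0 < u" "u < 1"
    and eq: "(1 - t) \<cdot>\<^sub>v p + t \<cdot>\<^sub>v q = (1 - u) \<cdot>\<^sub>v r + u \<cdot>\<^sub>v s"
    unfolding open_segment_vec_def by auto
  have "p $ i + q $ i = r $ i + s $ i" if "i < d" for i
  proof (rule crossing_coordinate_sums[OF _ _ _ _ t])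
    show "(1 - t) * p $ i + t * q $ i = (1 - u) * r $ i + u * s $ i"
      using arg_cong[OF eq, of "\<lambda>x. x $ i"] vs that by (auto simp: hypercube_vertices_def)
  qed (use vs that in \<open>auto simp: hypercube_vertices_def\<close>)
  with ne show False by blast
qed

definition bit_vec :: "nat \<Rightarrow> nat \<Rightarrow> real vec" where
  "bit_vec d m = vec d (\<lambda>i. of_bool (bit m i))"

lemma bit_vec_in_hypercube: "bit_vec d m \<in> hypercube_vertices d"
  by (auto simp: bit_vec_def hypercube_vertices_def)

text \<open>The weighted sum is linear in the vector. Hence equal coordinate sums of two edges give
  equal sums of the encoded numbers.\<close>

lemma sum_bit_vec: "m < 2 ^ d \<Longrightarrow> (\<Sum>i<d. 2 ^ i * bit_vec d m $ i) = real m"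
proof -
  assume "m < 2 ^ d"
  then have "real m = real (take_bit d m)"
    by (simp add: take_bit_nat_eq_self)
  also have "\<dots> = (\<Sum>i<d. 2 ^ i * bit_vec d m $ i)"
    by (simp add: take_bit_sum push_bit_eq_mult bit_vec_def lessThan_atLeast0 mult.commute)
  finally show ?thesis by simp
qed

text \<open>Labels run from 1 to \<open>2 ^ d\<close>, so they fit into \<open>d\<close> bits after
  subtracting 1. The shift cancels when two edge sums are compared.\<close>

lemma hypercube_drawing_of_antimagic:
  assumes graph: "simple_graph V E"
    and f: "antimagic_injection V E f" "f ` V \<subseteq> {1..2 ^ d}"
  shows "hypercube_drawing V E d (\<lambda>v. bit_vec d (f v - 1))"
proof -
  let ?l = "\<lambda>v. bit_vec d (f v - 1)"
  have sum_l: "(\<Sum>i<d. 2 ^ i * ?l v $ i) = real (f v) - 1" if "v \<in> V" for v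
  proof -
    have "1 \<le> f v" "f v \<le> 2 ^ d" using f(2) that by auto
    then show ?thesis by (subst sum_bit_vec) (auto simp: of_nat_diff)
  qed
  have "inj_on ?l V"
  proof (rule inj_onI)
    fix v w assume vw: "v \<in> V" "w \<in> V" "?l v = ?l w"
    then have "f v = f w" using sum_l[of v] sum_l[of w] by simp
    then show "v = w" using f(1) vw by (auto simp: antimagic_injection_def dest: inj_onD)
  qed
  moreover have "open_segment_vec (?l v) (?l w) \<inter> open_segment_vec (?l x) (?l y) = {}"
    if E: "{v, w} \<in> E" "{x, y} \<in> E" and ne: "{v, w} \<noteq> {x, y}" for v w x y
  proof (rule open_segments_disjoint; (rule bit_vec_in_hypercube)?)
    show "\<exists>i<d. ?l v $ i + ?l w $ i \<noteq> ?l x $ i + ?l y $ i"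
    proof (rule ccontr)
      assume "\<not> ?thesis"
      then have "(\<Sum>i<d. 2 ^ i * (?l v $ i + ?l w $ i)) = (\<Sum>i<d. 2 ^ i * (?l x $ i + ?l y $ i))"
        by (intro sum.cong) auto
      then have "real (f v) - 1 + (real (f w) - 1) = real (f x) - 1 + (real (f y) - 1)"
        using simple_graph_edgeD[OF graph E(1)] simple_graph_edgeD[OF graph E(2)]
        by (simp only: distrib_left sum.distrib sum_l)
      then have "f v + f w = f x + f y" by linarith
      then show False
        using f(1) E ne unfolding antimagic_injection_def by blast
    qed
  qed
  ultimately show ?thesis
    unfolding hypercube_drawing_def using bit_vec_in_hypercube by blast
qed

lemma vol_less_of_antimagic:
  assumes "simple_graph V E" "antimagic_injection V E f" "f ` V \<subseteq> {1..N}" "1 \<le> N"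
  shows "vol V E < 2 * N"
proof -
  \<comment> \<open>\<open>d\<close> is the logarithm of \<open>N\<close> to base 2, rounded up;
    \<open>N = 1\<close> needs \<open>d = 0\<close>.\<close>
  obtain d where d: "N \<le> 2 ^ d" "2 ^ d < 2 * N"
  proof (cases "N = 1")
    case True
    then show ?thesis using that[of 0] by simp
  next
    case False
    then obtain m where "2 ^ m < N" "N \<le> 2 ^ (m + 1)"
      using ex_power_ivl2[of 2 N] assms(4) by auto
    then show ?thesis using that[of "m + 1"] by simp
  qed
  have "f ` V \<subseteq> {1..2 ^ d}"
    using assms(3) d(1) by fastforce
  then have "hypercube_drawing V E d (\<lambda>v. bit_vec d (f v - 1))"
    using assms by (intro hypercube_drawing_of_antimagic)
  then have "vol V E \<le> 2 ^ d"
    unfolding vol_def by (intro Least_le) blast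
  with d(2) show ?thesis by linarith
qed

section \<open>The embedding that attains the bandwidth, and the final bounds\<close>

text \<open>\<open>LEAST\<close> has its property once some value does. Here \<open>card V\<close>
  is such a value for any numbering of the vertices, since two positions differ by less than
  that.\<close>

lemma subgraph_path_power_bandwidth:
  assumes "simple_graph V E"
  shows "subgraph_up_to_iso V E {..<card V} (path_power_edges (card V) (bandwidth V E))"
proof -
  have "finite V" using assms by (simp add: simple_graph_def)
  then obtain \<phi> where \<phi>: "bij_betw \<phi> V {..<card V}"
    using ex_bij_betw_finite_nat[of V] by (auto simp: lessThan_atLeast0)
  have "\<phi> ` e \<in> path_power_edges (card V) (card V)" if "e \<in> E" for e
  proof -
    have "card e = 2"
      using assms that by (auto simp: simple_graph_def nsets_def)
    then obtain v w where e: "e = {v, w}"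
      unfolding card_2_iff by blast
    then have vw: "v \<in> V" "w \<in> V" "v \<noteq> w"
      using simple_graph_edgeD[OF assms, of v w] that by auto
    then have "\<phi> v < card V" "\<phi> w < card V" "\<phi> v \<noteq> \<phi> w"
      using \<phi> by (auto simp: bij_betw_def inj_on_eq_iff)
    then show ?thesis
      unfolding path_power_edges_def e by (intro CollectI exI[of _ "\<phi> v"] exI[of _ "\<phi> w"]) auto
  qed
  then have "subgraph_up_to_iso V E {..<card V} (path_power_edges (card V) (card V))"
    using \<phi> unfolding subgraph_up_to_iso_def bij_betw_def by blast
  then show ?thesis
    unfolding bandwidth_def by (rule LeastI)
qed

theorem corollary2:
  fixes V :: "'a set" and E :: "'a set set" and n k :: nat
  assumes "simple_graph V E"
    and "card V = n"
    and "bandwidth V E = k"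
    and "1 \<le> k"
  shows "int (mag V E) \<le> 2 * int k * (2 * int n - 1) \<and>
         int (vol V E) < 4 * int k * (2 * int n - 1)"
proof -
  obtain \<phi> where \<phi>: "inj_on \<phi> V" "\<phi> ` V \<subseteq> {..<n}" "\<forall>e\<in>E. \<phi> ` e \<in> path_power_edges n k"
    using subgraph_path_power_bandwidth[OF assms(1)] assms by (auto simp: subgraph_up_to_iso_def)
  \<comment> \<open>The empty graph has bandwidth 0. With \<open>n\<close> positive, the natural
    number \<open>2 * n - 1\<close> agrees with the integer one.\<close>
  have n: "1 \<le> n"
  proof (rule ccontr)
    assume "\<not> 1 \<le> n"
    then have "card V = 0" using assms(2) by simp
    then have "V = {}" using assms(1) by (simp add: simple_graph_def)
    moreover from this have "E = {}"
      using assms(1) by (auto simp: simple_graph_def nsets_def)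
    ultimately have "bandwidth V E \<le> 0"
      unfolding bandwidth_def by (intro Least_le) (auto simp: subgraph_up_to_iso_def)
    then show False using assms by simp
  qed
  obtain p where p: "prime p" "k < p" "p \<le> 2 * k"
    using exists_prime_between[OF assms(4)] .
  define f where "f v = 2 * p * \<phi> v + (\<phi> v)\<^sup>2 mod p + 1" for v
  define N where "N = p * (2 * n - 1)"
  have f: "antimagic_injection V E f"
    unfolding f_def by (rule antimagic_injection_quadratic[OF assms(1) \<phi>(1,3) p(1,2)])
  have fN: "f ` V \<subseteq> {1..N}"
  proof
    fix m assume "m \<in> f ` V"
    then obtain v where v: "v \<in> V" "m = f v" by blast
    have "2 * p * \<phi> v \<le> 2 * p * (n - 1)"
      using \<phi>(2) v by (intro mult_left_mono) auto
    moreover have "(\<phi> v)\<^sup>2 mod p < p" using p by simp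
    \<comment> \<open>The last position \<open>n - 1\<close> with the largest residue
      \<open>p - 1\<close>, plus 1, gives exactly \<open>N\<close>.\<close>
    moreover have "2 * p * (n - 1) + p = N"
      using n by (cases n) (auto simp: N_def algebra_simps)
    ultimately have "f v \<le> N" unfolding f_def by linarith
    then show "m \<in> {1..N}" unfolding v by (simp add: f_def)
  qed
  have N: "int N \<le> 2 * int k * (2 * int n - 1)"
  proof -
    have "int N = int p * (2 * int n - 1)" using n by (simp add: N_def of_nat_diff)
    also have "\<dots> \<le> (2 * int k) * (2 * int n - 1)"
      using p(3) n by (intro mult_right_mono) auto
    finally show ?thesis .
  qed
  have "mag V E \<le> N"
    unfolding mag_def using f fN by (intro Least_le) blast
  moreover have "vol V E < 2 * N"
    using p n by (intro vol_less_of_antimagic[OF assms(1) f fN]) (auto simp: N_def Suc_leI)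
  ultimately show ?thesis using N by linarith
qed

end
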